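(* For integers $k\ge1$ and $m\ge0$ put $$J(k,m):=\int_0^1\frac{\ln^k(1-t)\,\ln^m(1+t)}{1+t}\,dt .$$ Then for all positive integers $m$ and $k$, $$\zeta\left(\bar1,\{1\}_{m-1},\bar1,\{1\}_{k-1}\right)=\frac{(-1)^{k-1}}{k!\,(m-1)!}J(k,m-1)-\sum_{i=1}^{m-1}\frac{(\ln2)^i}{i!}\,\zeta\left(\bar1,\{1\}_{m-1-i},\bar1,\{1\}_{k-1}\right).$$ Moreover, for all integers $k\ge1$ and $m\ge0$, the following two explicit formulas hold: $$\begin{aligned} J(k,m)=&\ \frac{(\ln2)^{m+k+1}}{m+1}+\sum_{i=1}^k\sum_{j=0}^m(-1)^{i+j}i!\,j!\,(\ln2)^{m+k-i-j}\binom ki\binom mj\,\zeta\left(j+2,\{1\}_{i-1}\right)\\ &-\sum_{i=1}^k\sum_{j=0}^m\sum_{l=0}^j(-1)^{i+j}i!\,l!\,(\ln2)^{m+k-i-l}\binom ki\binom mj\binom jl\,\zeta\left(l+2,\{1\}_{i-1};\tfrac12\right), \end{aligned}$$ and $$J(k,m)=\sum_{i=0}^k\sum_{j=0}^m\sum_{l=0}^i(-1)^{i+j}j!\,l!\,(\ln2)^{m+k-j-l}\binom ki\binom il\binom mj\,\zeta\left(l+1,\{1\}_j;\tfrac12\right).$$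
   Context: Notation. $\{1\}_r$ denotes the string of $r$ entries equal to $1$ (empty if $r=0$). For positive integers $s_1,\dots,s_r$, $\zeta(s_1,\dots,s_r):=\lim_{n\to\infty}\sum_{n\ge k_1>\cdots>k_r\ge1}\frac{1}{k_1^{s_1}\cdots k_r^{s_r}}$. A bar over an entry $s_j$ means that the factor $(-1)^{k_j}$ is inserted in the summand; e.g. $\zeta(\bar1,\{1\}_{m-1},\bar1,\{1\}_{k-1})=\lim_{n\to\infty}\sum_{n\ge k_1>\cdots>k_{m+k}\ge1}\frac{(-1)^{k_1+k_{m+1}}}{k_1k_2\cdots k_{m+k}}$. For $x\in[-1,1)$, $\zeta(s_1,\dots,s_r;x):=\sum_{k_1>\cdots>k_r\ge1}\frac{x^{k_1}}{k_1^{s_1}\cdots k_r^{s_r}}$. Sums over empty ranges are $0$. *)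

theory Defs
  imports "HOL-Analysis.Analysis"
begin

text \<open>The tuples \<open>n \<ge> k\<^sub>1 > \<dots> > k\<^sub>r \<ge> 1\<close>, as lists.\<close>

definition decr_tuples :: "nat \<Rightarrow> nat \<Rightarrow> nat list set" where
  "decr_tuples n r = {ks. length ks = r \<and> sorted_wrt (>) ks \<and> set ks \<subseteq> {1..n}}"

text \<open>An argument of a multiple zeta value; \<open>Barred s\<close> carries the additional sign \<open>(-1)\<^sup>k\<close>.\<close>

datatype zeta_arg = Plain nat | Barred nat

primrec zeta_factor :: "zeta_arg \<Rightarrow> nat \<Rightarrow> real" where
  "zeta_factor (Plain s) k = 1 / real k ^ s"
| "zeta_factor (Barred s) k = (-1) ^ k / real k ^ s"

text \<open>Alternating multiple zeta values converge only conditionally in general, so the value is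
  the limit of the sums truncated at \<open>k\<^sub>1 \<le> n\<close>, not an unordered sum over all tuples.\<close>

definition mzeta :: "zeta_arg list \<Rightarrow> real" where
  "mzeta ss = lim (\<lambda>n. \<Sum>ks\<in>decr_tuples n (length ss).
     \<Prod>j<length ss. zeta_factor (ss ! j) (ks ! j))"

text \<open>\<open>\<zeta>(s\<^sub>1,\<dots>,s\<^sub>r;x)\<close> for \<open>r \<ge> 1\<close> and \<open>x \<in> [-1,1)\<close>; at \<open>x = -1\<close> the same remark applies.\<close>

definition mzeta_at :: "nat list \<Rightarrow> real \<Rightarrow> real" where
  "mzeta_at ss x = lim (\<lambda>n. \<Sum>ks\<in>decr_tuples n (length ss).
     x ^ hd ks / (\<Prod>j<length ss. real (ks ! j) ^ (ss ! j)))"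

text \<open>The integrand is unbounded at \<open>t = 1\<close> for \<open>k \<ge> 1\<close>; the Henstock-Kurzweil integral covers
  this, and the value \<open>ln 0 = 0\<close> at that single point is immaterial.\<close>

definition J :: "nat \<Rightarrow> nat \<Rightarrow> real" where
  "J k m = integral {0..1} (\<lambda>t. ln (1 - t) ^ k * ln (1 + t) ^ m / (1 + t))"

end

theory Submission
  imports Defs "HOL-Real_Asymp.Real_Asymp"
begin

text \<open>All identities come from the fundamental theorem of calculus on \<open>[0, 1]\<close>, applied to explicit primitives
  built from \<open>\<zeta>(s, {1}\<^sub>r; x)\<close> and logarithms. The series \<open>\<zeta>(1, {1}\<^sub>r; x)\<close> equals \<open>(- ln (1 - x)) ^ (r + 1) / (r + 1)!\<close>,
  and differentiation lowers the first argument of \<open>\<zeta>(s, \<dots>; x)\<close> by one. Expanding the integrand of \<open>J\<close>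
  in powers of \<open>ln ((1 - t) / 2)\<close> and \<open>ln ((1 + t) / 2)\<close> reduces the explicit formulas to primitives in
  \<open>u = (1 + t) / 2\<close> (first formula) and \<open>v = (1 - t) / 2\<close> (second formula).\<close>

section \<open>Nested sums\<close>

text \<open>Halving makes the two arguments add up to 1: with u = (1 + t) / 2 one has (1 - t) / 2 =
  1 - u and dt / (1 + t) = du / u, so a power of ln (1 - u), itself a polylogarithm up to a
  constant, can be integrated by parts against powers of ln u. The price is the powers of ln 2. The
  point t = 0 is u = v = 1/2, hence the values at 1/2 in both formulas; t = 1 is u = 1, which
  contributes the zeta values at 1, or v = 0, which contributes nothing. The obstacle is t = 1,
  where ln (1 - t) is unbounded and the series for the alternating values converges only
  conditionally. The fundamental theorem is used with derivatives on the open interval and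
  continuity on the closed one, so integrability comes for free and the real work is continuity of
  the primitives at the endpoints: by domination at u = 1, by a first-order zero at v = 0, and by
  summation by parts at x = -1.\<close>

fun nested_sum :: "zeta_arg list \<Rightarrow> nat \<Rightarrow> real" where
  "nested_sum [] n = 1"
| "nested_sum (z # zs) n = (\<Sum>k<n. zeta_factor z (Suc k) * nested_sum zs k)"

lemma decr_tuples_Suc:
  "decr_tuples n (Suc r) = (\<lambda>(k, ks). Suc k # ks) ` (SIGMA k:{..<n}. decr_tuples k r)"
proof (intro equalityI subsetI)
  fix xs assume xs: "xs \<in> decr_tuples n (Suc r)"
  then obtain x ks where xs_eq: "xs = x # ks" by (cases xs) (auto simp: decr_tuples_def)
  have x: "x \<in> {1..n}" and len: "length ks = r" and less: "\<forall>y\<in>set ks. y < x"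
    and sorted: "sorted_wrt (>) ks" and sub: "set ks \<subseteq> {1..n}"
    using xs by (auto simp: decr_tuples_def xs_eq)
  from x obtain k where k: "x = Suc k" by (cases x) auto
  have "ks \<in> decr_tuples k r"
    using len less sorted sub by (auto simp: decr_tuples_def k less_Suc_eq_le)
  then show "xs \<in> (\<lambda>(k, ks). Suc k # ks) ` (SIGMA k:{..<n}. decr_tuples k r)"
    using x by (force simp: xs_eq k)
next
  fix xs assume "xs \<in> (\<lambda>(k, ks). Suc k # ks) ` (SIGMA k:{..<n}. decr_tuples k r)"
  then show "xs \<in> decr_tuples n (Suc r)"
    by (force simp: decr_tuples_def)
qed

lemma decr_tuples_0: "decr_tuples n 0 = {[]}"
  by (auto simp: decr_tuples_def)

lemma finite_decr_tuples: "finite (decr_tuples n r)"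
  by (induction r arbitrary: n) (simp_all add: decr_tuples_0 decr_tuples_Suc)

lemma sum_decr_tuples_Suc:
  fixes f :: "nat list \<Rightarrow> real"
  shows "(\<Sum>ks\<in>decr_tuples n (Suc r). f ks) = (\<Sum>k<n. \<Sum>ks\<in>decr_tuples k r. f (Suc k # ks))"
proof -
  have "inj_on (\<lambda>(k, ks). Suc k # ks) (SIGMA k:{..<n}. decr_tuples k r)"
    by (auto simp: inj_on_def)
  then have "(\<Sum>ks\<in>decr_tuples n (Suc r). f ks) =
      (\<Sum>(k, ks)\<in>(SIGMA k:{..<n}. decr_tuples k r). f (Suc k # ks))"
    by (simp add: decr_tuples_Suc sum.reindex case_prod_unfold)
  then show ?thesis
    by (simp add: sum.Sigma finite_decr_tuples)
qed

text \<open>Strict decrease is built into the index shift: below an outermost index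
  \<open>Suc k\<close> the remaining indices run up to \<open>k\<close>.\<close>

lemma sum_decr_tuples_eq_nested_sum:
  "(\<Sum>ks\<in>decr_tuples n (length zs). \<Prod>j<length zs. zeta_factor (zs ! j) (ks ! j)) = nested_sum zs n"
proof (induction zs arbitrary: n)
  case Nil
  then show ?case by (simp add: decr_tuples_0)
next
  case (Cons z zs)
  show ?case
    by (simp add: sum_decr_tuples_Suc prod.lessThan_Suc_shift Cons flip: sum_distrib_left del: prod.lessThan_Suc)
qed

lemma sum_decr_tuples_at:
  "(\<Sum>ks\<in>decr_tuples n (length (s # ss)). x ^ hd ks / (\<Prod>j<length (s # ss). real (ks ! j) ^ ((s # ss) ! j))) =
   (\<Sum>k<n. nested_sum (map Plain ss) k / real (Suc k) ^ s * x ^ Suc k)"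
proof -
  have "nested_sum (map Plain ss) k =
      (\<Sum>ks\<in>decr_tuples k (length ss). 1 / (\<Prod>j<length ss. real (ks ! j) ^ (ss ! j)))" for k
    unfolding sum_decr_tuples_eq_nested_sum[symmetric]
    by (intro sum.cong) (simp_all add: prod_dividef)
  then show ?thesis
    by (simp add: sum_decr_tuples_Suc prod.lessThan_Suc_shift sum_divide_distrib sum_distrib_left
        sum_distrib_right mult_ac del: prod.lessThan_Suc)
qed

text \<open>With \<open>a = nested_sum zs\<close> this is \<open>\<zeta>(s, zs; x)\<close>; the outermost summation index is \<open>n + 1\<close>.\<close>

definition genpolylog :: "(nat \<Rightarrow> real) \<Rightarrow> nat \<Rightarrow> real \<Rightarrow> real" where
  "genpolylog a s x = (\<Sum>n. a n / real (Suc n) ^ s * x ^ Suc n)"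

text \<open>\<open>lim\<close> says nothing about a divergent sequence, so this and the next two
  translations carry summability as an assumption, discharged where they are used.\<close>

lemma mzeta_at_eq_genpolylog:
  assumes "summable (\<lambda>n. nested_sum (map Plain ss) n / real (Suc n) ^ s * x ^ Suc n)"
  shows "mzeta_at (s # ss) x = genpolylog (nested_sum (map Plain ss)) s x"
  unfolding mzeta_at_def sum_decr_tuples_at genpolylog_def
  by (intro limI summable_LIMSEQ assms)

lemma mzeta_Plain_eq_genpolylog:
  assumes "summable (\<lambda>n. nested_sum zs n / real (Suc n) ^ s * 1 ^ Suc n)"
  shows "mzeta (Plain s # zs) = genpolylog (nested_sum zs) s 1"
  using summable_LIMSEQ[OF assms]
  unfolding mzeta_def sum_decr_tuples_eq_nested_sum genpolylog_def
  by (intro limI) (simp add: mult_ac)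

lemma mzeta_Barred_eq_genpolylog:
  assumes "summable (\<lambda>n. nested_sum zs n / real (Suc n) ^ s * (-1) ^ Suc n)"
  shows "mzeta (Barred s # zs) = genpolylog (nested_sum zs) s (-1)"
  using summable_LIMSEQ[OF assms]
  unfolding mzeta_def sum_decr_tuples_eq_nested_sum genpolylog_def
  by (intro limI) (simp add: mult_ac)

section \<open>Growth of nested sums\<close>

text \<open>Logarithmic growth would be sharper, but this bound is preserved by \<open>a \<mapsto> (\<Sum>k<n. a k / (k + 1))\<close>
  up to a factor 2 and still makes exponents \<open>s \<ge> 2\<close> absolutely summable.\<close>

definition sqrt_bounded :: "(nat \<Rightarrow> real) \<Rightarrow> bool" where
  "sqrt_bounded a \<longleftrightarrow> (\<exists>C. \<forall>n. \<bar>a n\<bar> \<le> C * sqrt (real (Suc n)))"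

text \<open>The summand 1 / sqrt (n + 1) is at most 2 (sqrt (n + 1) - sqrt n), and these bounds
  telescope.\<close>

lemma sum_inverse_sqrt_le: "(\<Sum>k<n. 1 / sqrt (real (Suc k))) \<le> 2 * sqrt (real n)"
proof (induction n)
  case (Suc n)
  have "0 \<le> (sqrt (real (Suc n)) - sqrt (real n))\<^sup>2" by simp
  also have "\<dots> = 2 * real n + 1 - 2 * sqrt (real (Suc n)) * sqrt (real n)"
    by (simp add: power2_diff)
  finally have "1 / sqrt (real (Suc n)) \<le> 2 * sqrt (real (Suc n)) - 2 * sqrt (real n)"
    by (simp add: field_simps)
  then show ?case using Suc by simp
qed simp

lemma sqrt_bounded_nested_sum:
  assumes "set zs \<subseteq> {Plain 1, Barred 1}"
  shows "sqrt_bounded (nested_sum zs)"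
  using assms
proof (induction zs)
  case Nil
  show ?case unfolding sqrt_bounded_def by (intro exI[of _ 1]) simp
next
  case (Cons z zs)
  then obtain C where C: "\<And>n. \<bar>nested_sum zs n\<bar> \<le> C * sqrt (real (Suc n))"
    unfolding sqrt_bounded_def by auto
  have C0: "C \<ge> 0" using C[of 0] by simp
  have z: "\<bar>zeta_factor z (Suc k)\<bar> = 1 / real (Suc k)" for k
    using Cons.prems by (auto simp: abs_mult power_abs)
  have "\<bar>nested_sum (z # zs) n\<bar> \<le> 2 * C * sqrt (real (Suc n))" for n
  proof -
    have "\<bar>nested_sum (z # zs) n\<bar> \<le> (\<Sum>k<n. \<bar>zeta_factor z (Suc k) * nested_sum zs k\<bar>)"
      by (simp add: sum_abs)
    also have "\<dots> \<le> (\<Sum>k<n. C * (1 / sqrt (real (Suc k))))"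
    proof (rule sum_mono)
      fix k
      have "\<bar>zeta_factor z (Suc k) * nested_sum zs k\<bar> \<le> 1 / real (Suc k) * (C * sqrt (real (Suc k)))"
        unfolding abs_mult z using C by (intro mult_left_mono) auto
      also have "\<dots> = C * (1 / sqrt (real (Suc k)))"
        by (simp add: real_div_sqrt field_simps)
      finally show "\<bar>zeta_factor z (Suc k) * nested_sum zs k\<bar> \<le> C * (1 / sqrt (real (Suc k)))" .
    qed
    also have "\<dots> = C * (\<Sum>k<n. 1 / sqrt (real (Suc k)))"
      by (simp add: sum_distrib_left)
    also have "\<dots> \<le> C * (2 * sqrt (real n))"
      by (intro mult_left_mono sum_inverse_sqrt_le C0)
    also have "\<dots> \<le> C * (2 * sqrt (real (Suc n)))"
      by (intro mult_left_mono C0) auto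
    finally show ?thesis by simp
  qed
  then show ?case unfolding sqrt_bounded_def by blast
qed

lemma summable_sqrt_div_square: "summable (\<lambda>n. sqrt (real (Suc n)) / real (Suc n) ^ 2)"
proof -
  have "summable (\<lambda>n. real (Suc n) powr (-3/2))"
    using summable_real_powr_iff[of "-3/2"] by (subst summable_Suc_iff) simp
  moreover have "sqrt (real (Suc n)) / real (Suc n) ^ 2 = real (Suc n) powr (-3/2)" for n
  proof -
    have "real (Suc n) powr (-3/2) = real (Suc n) powr (1/2 - 2)" by simp
    also have "\<dots> = sqrt (real (Suc n)) / real (Suc n) ^ 2"
      by (simp only: powr_diff powr_half_sqrt) (simp add: powr_numeral)
    finally show ?thesis by simp
  qed
  ultimately show ?thesis by simp
qed

lemma sqrt_bounded_summable:
  assumes "sqrt_bounded a" "\<bar>x\<bar> < 1"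
  shows "summable (\<lambda>n. a n / real (Suc n) ^ s * x ^ n)"
proof -
  from assms obtain C where C: "\<And>n. \<bar>a n\<bar> \<le> C * sqrt (real (Suc n))"
    unfolding sqrt_bounded_def by auto
  have C0: "C \<ge> 0" using C[of 0] by simp
  \<comment> \<open>For |x| < 1 the coarser bound sqrt (n + 1) \<le> n + 1 suffices; it leads to the
    differentiated geometric series.\<close>
  have "summable (\<lambda>n. C * (of_nat (Suc n) * \<bar>x\<bar> ^ n))"
    using geometric_deriv_sums[of "\<bar>x\<bar>"] assms(2) by (intro summable_mult) (auto simp: summable_def)
  then show ?thesis
  proof (rule summable_comparison_test')
    fix n
    have "\<bar>a n\<bar> \<le> C * sqrt (real (Suc n) ^ 2)"
      by (rule order_trans[OF C]) (intro mult_left_mono real_sqrt_le_mono C0, auto simp: power2_eq_square)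
    then have "\<bar>a n\<bar> \<le> C * real (Suc n)" by simp
    moreover have "\<bar>a n\<bar> / real (Suc n) ^ s \<le> \<bar>a n\<bar> / 1"
      by (intro divide_left_mono) (auto intro: one_le_power)
    ultimately have "\<bar>a n\<bar> / real (Suc n) ^ s \<le> C * real (Suc n)" by simp
    then have "\<bar>a n\<bar> / real (Suc n) ^ s * \<bar>x\<bar> ^ n \<le> C * real (Suc n) * \<bar>x\<bar> ^ n"
      by (intro mult_right_mono) auto
    then show "norm (a n / real (Suc n) ^ s * x ^ n) \<le> C * (of_nat (Suc n) * \<bar>x\<bar> ^ n)"
      by (simp add: abs_mult power_abs mult_ac)
  qed
qed

lemma sqrt_bounded_summable_Suc:
  assumes "sqrt_bounded a" "\<bar>x\<bar> < 1"
  shows "summable (\<lambda>n. a n / real (Suc n) ^ s * x ^ Suc n)"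
  using summable_mult[OF sqrt_bounded_summable[OF assms, of s], of x] by (simp add: mult_ac)

section \<open>Generalized polylogarithms\<close>

lemma genpolylog_0: "genpolylog a s 0 = 0"
  by (simp add: genpolylog_def)

text \<open>The derivative is kept as a power series instead of \<open>genpolylog a s x / x\<close>
  so that x = 0 is covered; both the constancy argument in \<open>nested_sum_ones_series\<close> and
  the limit at 0 in \<open>continuous_on_log_power_genpolylog\<close> use that point.\<close>

lemma has_real_derivative_genpolylog:
  assumes "sqrt_bounded a" "\<bar>x\<bar> < 1"
  shows "(genpolylog a (Suc s) has_real_derivative (\<Sum>n. a n / real (Suc n) ^ s * x ^ n)) (at x)"
proof -
  have eq: "a n / real (Suc n) ^ Suc s * real (Suc n) = a n / real (Suc n) ^ s" for n
    by (simp del: of_nat_Suc)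
  have "((\<lambda>x. \<Sum>n. a n / real (Suc n) ^ Suc s * x ^ Suc n) has_real_derivative
      (\<Sum>n. a n / real (Suc n) ^ Suc s * real (Suc n) * x ^ n)) (at x)"
  proof (rule DERIV_power_series'[where R = 1])
    fix y :: real assume "y \<in> {-1<..<1}"
    then show "summable (\<lambda>n. a n / real (Suc n) ^ Suc s * real (Suc n) * y ^ n)"
      unfolding eq by (intro sqrt_bounded_summable assms) auto
  qed (use assms in auto)
  then show ?thesis
    unfolding genpolylog_def[abs_def] eq .
qed

lemma has_real_derivative_genpolylog_div:
  assumes "sqrt_bounded a" "\<bar>x\<bar> < 1" "x \<noteq> 0"
  shows "(genpolylog a (Suc s) has_real_derivative genpolylog a s x / x) (at x)"
proof -
  have "genpolylog a s x = x * (\<Sum>n. a n / real (Suc n) ^ s * x ^ n)"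
    unfolding genpolylog_def
    by (subst suminf_mult[OF sqrt_bounded_summable[OF assms(1,2)], symmetric]) (simp add: mult_ac)
  then show ?thesis
    using has_real_derivative_genpolylog[OF assms(1,2), of s] assms(3) by simp
qed

section \<open>Summation by parts and generating functions of nested sums\<close>

text \<open>Multiplying by 1 - x turns coefficients into their differences. For nested sums the
  differences give the series one level down; near x = -1 they decay fast enough for absolute
  convergence.\<close>

lemma telescope_power_series:
  fixes b :: "nat \<Rightarrow> real"
  assumes "x \<noteq> 1" "(\<lambda>n. b n * x ^ n) \<longlonglongrightarrow> 0"
    and "(\<lambda>n. (b (Suc n) - b n) * x ^ Suc n) sums d"
  shows "(\<lambda>n. b n * x ^ n) sums ((b 0 + d) / (1 - x))"
proof -
  have partial: "(1 - x) * (\<Sum>n<N. b n * x ^ n) =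
      b 0 + (\<Sum>n<N. (b (Suc n) - b n) * x ^ Suc n) - b N * x ^ N" for N
    by (induction N) (simp_all only: sum.lessThan_Suc lessThan_0 sum.empty distrib_left,
        simp_all add: algebra_simps)
  have "(\<lambda>N. (b 0 + (\<Sum>n<N. (b (Suc n) - b n) * x ^ Suc n) - b N * x ^ N) / (1 - x))
      \<longlonglongrightarrow> (b 0 + d - 0) / (1 - x)"
    using assms unfolding sums_def by (intro tendsto_intros) auto
  then show ?thesis
    unfolding sums_def partial[symmetric] using assms(1) by simp
qed

lemma nested_sum_Plain_series:
  assumes "set zs \<subseteq> {Plain 1, Barred 1}" "\<bar>x\<bar> < 1"
  shows "(\<Sum>n. nested_sum (Plain 1 # zs) n * x ^ n) = genpolylog (nested_sum zs) 1 x / (1 - x)"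
proof -
  have "sqrt_bounded (nested_sum (Plain 1 # zs))" "sqrt_bounded (nested_sum zs)"
    using assms by (auto intro!: sqrt_bounded_nested_sum simp del: nested_sum.simps)
  note summables = sqrt_bounded_summable[OF this(1) assms(2), of 0]
    sqrt_bounded_summable_Suc[OF this(2) assms(2), of 1]
  have "(\<lambda>n. nested_sum (Plain 1 # zs) n * x ^ n) sums
      ((nested_sum (Plain 1 # zs) 0 + genpolylog (nested_sum zs) 1 x) / (1 - x))"
  proof (rule telescope_power_series)
    show "(\<lambda>n. nested_sum (Plain 1 # zs) n * x ^ n) \<longlonglongrightarrow> 0"
      using summable_LIMSEQ_zero[OF summables(1)] by simp
    show "(\<lambda>n. (nested_sum (Plain 1 # zs) (Suc n) - nested_sum (Plain 1 # zs) n) * x ^ Suc n)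
        sums genpolylog (nested_sum zs) 1 x"
      using summable_sums[OF summables(2)] by (simp add: genpolylog_def)
  qed (use assms in auto)
  then show ?thesis by (simp add: sums_iff)
qed

text \<open>The increments carry the sign (-1)^(n + 1), which merges with x^(n + 1) into a power of
  -x: a barred entry reflects the argument.\<close>

lemma nested_sum_Barred_series:
  assumes "set zs \<subseteq> {Plain 1, Barred 1}" "\<bar>x\<bar> < 1"
  shows "(\<Sum>n. nested_sum (Barred 1 # zs) n * x ^ n) = genpolylog (nested_sum zs) 1 (-x) / (1 - x)"
proof -
  have "sqrt_bounded (nested_sum (Barred 1 # zs))" "sqrt_bounded (nested_sum zs)"
    using assms by (auto intro!: sqrt_bounded_nested_sum simp del: nested_sum.simps)
  note summables = sqrt_bounded_summable[OF this(1) assms(2), of 0]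
    sqrt_bounded_summable_Suc[OF this(2), of "-x" 1]
  have "(\<lambda>n. nested_sum (Barred 1 # zs) n * x ^ n) sums
      ((nested_sum (Barred 1 # zs) 0 + genpolylog (nested_sum zs) 1 (-x)) / (1 - x))"
  proof (rule telescope_power_series)
    show "(\<lambda>n. nested_sum (Barred 1 # zs) n * x ^ n) \<longlonglongrightarrow> 0"
      using summable_LIMSEQ_zero[OF summables(1)] by simp
    have "nested_sum zs n / real (Suc n) ^ 1 * (-x) ^ Suc n =
        (nested_sum (Barred 1 # zs) (Suc n) - nested_sum (Barred 1 # zs) n) * x ^ Suc n" for n
      by (simp add: power_minus[of x n])
    then show "(\<lambda>n. (nested_sum (Barred 1 # zs) (Suc n) - nested_sum (Barred 1 # zs) n) * x ^ Suc n)
        sums genpolylog (nested_sum zs) 1 (-x)"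
      using summable_sums[OF summables(2)] assms(2) by (simp only: genpolylog_def abs_minus)
  qed (use assms in auto)
  then show ?thesis by (simp add: sums_iff)
qed

text \<open>The two identities climb alternately: integrating the first for r gives the second for
  r, and dividing that by 1 - x gives the first for r + 1. For use inside the induction,
  \<open>step\<close> takes the first identity as a premise.\<close>

lemma nested_sum_ones_series:
  assumes "\<bar>x\<bar> < 1"
  shows "(\<Sum>n. nested_sum (replicate r (Plain 1)) n * x ^ n) = (- ln (1 - x)) ^ r / fact r / (1 - x)"
    and "genpolylog (nested_sum (replicate r (Plain 1))) 1 x = (- ln (1 - x)) ^ Suc r / fact (Suc r)"
proof -
  have step: "genpolylog (nested_sum (replicate r (Plain 1))) 1 x = (- ln (1 - x)) ^ Suc r / fact (Suc r)"
    if ser: "\<And>x. \<bar>x\<bar> < 1 \<Longrightarrow>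
      (\<Sum>n. nested_sum (replicate r (Plain 1)) n * x ^ n) = (- ln (1 - x)) ^ r / fact r / (1 - x)"
      and x: "\<bar>x\<bar> < 1" for r and x :: real
  proof -
    define f where "f x = genpolylog (nested_sum (replicate r (Plain 1))) 1 x
      - (- ln (1 - x)) ^ Suc r / fact (Suc r)" for x
    have "(f has_real_derivative 0) (at y)" if y: "y \<in> {-1<..<1}" for y
    proof -
      have "sqrt_bounded (nested_sum (replicate r (Plain 1)))"
        by (intro sqrt_bounded_nested_sum) auto
      from has_real_derivative_genpolylog[OF this, of y 0] ser[of y] y
      have 1: "(genpolylog (nested_sum (replicate r (Plain 1))) 1 has_real_derivative
          (- ln (1 - y)) ^ r / fact r / (1 - y)) (at y)"
        by (simp add: abs_less_iff)
      have 2: "((\<lambda>x. (- ln (1 - x)) ^ Suc r / fact (Suc r)) has_real_derivative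
          real (Suc r) * (- ln (1 - y)) ^ r * (1 / (1 - y)) / fact (Suc r)) (at y)"
        using y by (auto intro!: derivative_eq_intros simp del: power_Suc)
      have "(- ln (1 - y)) ^ r / fact r / (1 - y)
          - real (Suc r) * (- ln (1 - y)) ^ r * (1 / (1 - y)) / fact (Suc r) = 0"
        by (simp del: of_nat_Suc)
      with DERIV_diff[OF 1 2] show ?thesis
        unfolding f_def[abs_def] by simp
    qed
    then have "f x = f 0"
      using x by (intro DERIV_isconst3[of "-1" 1]) auto
    then show ?thesis by (simp add: f_def genpolylog_0)
  qed
  have ser: "(\<Sum>n. nested_sum (replicate r (Plain 1)) n * x ^ n) = (- ln (1 - x)) ^ r / fact r / (1 - x)"
    if "\<bar>x\<bar> < 1" for r and x :: real
    using that
  proof (induction r arbitrary: x)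
    case 0
    then show ?case by (simp add: suminf_geometric)
  next
    case (Suc r)
    have "(\<Sum>n. nested_sum (Plain 1 # replicate r (Plain 1)) n * x ^ n) =
        genpolylog (nested_sum (replicate r (Plain 1))) 1 x / (1 - x)"
      using Suc.prems by (intro nested_sum_Plain_series) auto
    also have "genpolylog (nested_sum (replicate r (Plain 1))) 1 x = (- ln (1 - x)) ^ Suc r / fact (Suc r)"
      using Suc by (intro step) auto
    finally show ?case by (simp only: replicate_Suc)
  qed
  show "(\<Sum>n. nested_sum (replicate r (Plain 1)) n * x ^ n) = (- ln (1 - x)) ^ r / fact r / (1 - x)"
    using ser assms .
  show "genpolylog (nested_sum (replicate r (Plain 1))) 1 x = (- ln (1 - x)) ^ Suc r / fact (Suc r)"
    using step[OF ser assms] .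
qed

section \<open>Continuity of polylogarithms up to x = 1 and x = -1\<close>

text \<open>With s \<ge> 2 the terms are dominated on all of [-1, 1] by a multiple of (n +
  1)^(-3/2). This reaches x = 1, where the first formula evaluates its primitive.\<close>

lemma genpolylog_at_1:
  assumes "sqrt_bounded a" "s \<ge> 2"
  shows "summable (\<lambda>n. a n / real (Suc n) ^ s * 1 ^ Suc n)"
    and "continuous_on {-1..1} (genpolylog a s)"
proof -
  from assms obtain C where C: "\<And>n. \<bar>a n\<bar> \<le> C * sqrt (real (Suc n))"
    unfolding sqrt_bounded_def by auto
  define M where "M n = C * (sqrt (real (Suc n)) / real (Suc n) ^ 2)" for n
  have M: "summable M" unfolding M_def by (intro summable_mult summable_sqrt_div_square)
  have bound: "norm (a n / real (Suc n) ^ s * x ^ Suc n) \<le> M n" if "\<bar>x\<bar> \<le> 1" for n x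
  proof -
    have "\<bar>a n\<bar> / real (Suc n) ^ s \<le> \<bar>a n\<bar> / real (Suc n) ^ 2"
      using assms(2) by (intro divide_left_mono power_increasing) (auto simp del: power_Suc)
    also have "\<dots> \<le> M n"
      unfolding M_def using C[of n] by (simp add: divide_right_mono)
    finally have 1: "\<bar>a n\<bar> / real (Suc n) ^ s \<le> M n" .
    have "\<bar>x\<bar> ^ Suc n \<le> 1" using that by (intro power_le_one) auto
    then have "\<bar>a n\<bar> / real (Suc n) ^ s * \<bar>x\<bar> ^ Suc n \<le> \<bar>a n\<bar> / real (Suc n) ^ s * 1"
      by (intro mult_left_mono) auto
    with 1 show ?thesis by (simp add: abs_mult power_abs del: power_Suc)
  qed
  show "summable (\<lambda>n. a n / real (Suc n) ^ s * 1 ^ Suc n)"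
    by (rule summable_comparison_test'[OF M]) (rule bound, simp)
  have "uniform_limit {-1..1} (\<lambda>N x. \<Sum>n<N. a n / real (Suc n) ^ s * x ^ Suc n)
      (genpolylog a s) sequentially"
    unfolding genpolylog_def[abs_def]
    by (intro Weierstrass_m_test[OF _ M] bound) auto
  then show "continuous_on {-1..1} (genpolylog a s)"
    by (rule uniform_limit_theorem[rotated]) (auto intro!: always_eventually continuous_intros)
qed

text \<open>Near \<open>x = -1\<close>, multiplying the series by \<open>1 - x\<close> replaces its coefficients by their differences,
  which are absolutely summable; this replaces an appeal to Abel's limit theorem.\<close>

lemma genpolylog_at_minus_1:
  assumes "sqrt_bounded a" "sqrt_bounded (\<lambda>n. real (Suc n) * (a (Suc n) - a n))"
  shows "summable (\<lambda>n. a n / real (Suc n) ^ 1 * (-1) ^ Suc n)"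
    and "continuous_on {-1..0} (genpolylog a 1)"
proof -
  obtain C where C: "\<And>n. \<bar>a n\<bar> \<le> C * sqrt (real (Suc n))"
    using assms(1) unfolding sqrt_bounded_def by auto
  obtain D where D: "\<And>n. \<bar>real (Suc n) * (a (Suc n) - a n)\<bar> \<le> D * sqrt (real (Suc n))"
    using assms(2) unfolding sqrt_bounded_def by auto
  define b where "b n = a n / real (Suc n) ^ 1" for n
  define M where "M n = (C + D) * (sqrt (real (Suc n)) / real (Suc n) ^ 2)" for n
  have M: "summable M" unfolding M_def by (intro summable_mult summable_sqrt_div_square)
  have diff: "\<bar>b (Suc n) - b n\<bar> \<le> M n" for n
  proof -
    \<comment> \<open>This numerator explains the weight \<open>Suc n\<close> in the second
      assumption: both of its terms are O(sqrt n), so the difference is O(n^(-3/2)).\<close>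
    have "b (Suc n) - b n =
        (real (Suc n) * (a (Suc n) - a n) - a n) / (real (Suc n) * real (Suc (Suc n)))"
      by (simp add: b_def field_simps del: of_nat_Suc) (simp add: algebra_simps)
    also have "\<bar>\<dots>\<bar> = \<bar>real (Suc n) * (a (Suc n) - a n) - a n\<bar> / (real (Suc n) * real (Suc (Suc n)))"
      by (simp add: abs_mult del: of_nat_Suc)
    also have "\<dots> \<le> ((C + D) * sqrt (real (Suc n))) / (real (Suc n) * real (Suc (Suc n)))"
      using C[of n] D[of n] by (intro divide_right_mono) (auto simp: distrib_right)
    also have "\<dots> \<le> ((C + D) * sqrt (real (Suc n))) / (real (Suc n) * real (Suc n))"
    proof (intro divide_left_mono mult_left_mono)
      have "0 \<le> C * sqrt (real (Suc n)) + D * sqrt (real (Suc n))"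
        using C[of n] D[of n] by linarith
      then show "0 \<le> (C + D) * sqrt (real (Suc n))" by (simp add: distrib_right)
    qed auto
    finally show ?thesis by (simp add: M_def power2_eq_square)
  qed
  have b0: "b \<longlonglongrightarrow> 0"
  proof (rule tendsto_rabs_zero_cancel, rule tendsto_sandwich[where f = "\<lambda>_. 0"])
    show "(\<lambda>n. C * (1 / sqrt (real (Suc n)))) \<longlonglongrightarrow> 0" by real_asymp
    have "\<bar>b n\<bar> \<le> C * (1 / sqrt (real (Suc n)))" for n
    proof -
      have "\<bar>b n\<bar> \<le> (C * sqrt (real (Suc n))) / real (Suc n)"
        unfolding b_def using C[of n] by (simp add: divide_right_mono)
      also have "\<dots> = C * (1 / sqrt (real (Suc n)))"
        by (simp add: real_div_sqrt field_simps)
      finally show ?thesis .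
    qed
    then show "\<forall>\<^sub>F n in sequentially. \<bar>b n\<bar> \<le> C * (1 / sqrt (real (Suc n)))" by simp
  qed auto
  define d where "d x = (\<Sum>n. (b (Suc n) - b n) * x ^ Suc n)" for x
  have bound: "norm ((b (Suc n) - b n) * x ^ Suc n) \<le> M n" if "\<bar>x\<bar> \<le> 1" for n x
  proof -
    have "\<bar>b (Suc n) - b n\<bar> * \<bar>x\<bar> ^ Suc n \<le> \<bar>b (Suc n) - b n\<bar> * 1"
      using that by (intro mult_left_mono power_le_one) auto
    with diff[of n] show ?thesis by (simp add: abs_mult power_abs del: power_Suc)
  qed
  have sums: "(\<lambda>n. b n * x ^ n) sums ((b 0 + d x) / (1 - x))" if x: "x \<in> {-1..0}" for x
  proof (rule telescope_power_series)
    show "x \<noteq> 1" using x by auto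
    show "(\<lambda>n. (b (Suc n) - b n) * x ^ Suc n) sums d x"
      unfolding d_def
      by (intro summable_sums summable_comparison_test'[OF M] bound) (use x in auto)
    show "(\<lambda>n. b n * x ^ n) \<longlonglongrightarrow> 0"
    proof (rule tendsto_rabs_zero_cancel, rule tendsto_sandwich[where f = "\<lambda>_. 0"])
      show "(\<lambda>n. \<bar>b n\<bar>) \<longlonglongrightarrow> 0" using b0 by (rule tendsto_rabs_zero)
      have "\<bar>b n * x ^ n\<bar> \<le> \<bar>b n\<bar>" for n
        using x by (auto simp: abs_mult power_abs intro!: mult_left_le power_le_one)
      then show "\<forall>\<^sub>F n in sequentially. \<bar>b n * x ^ n\<bar> \<le> \<bar>b n\<bar>" by simp
    qed auto
  qed
  have sums': "(\<lambda>n. a n / real (Suc n) ^ 1 * x ^ Suc n) sums (x * ((b 0 + d x) / (1 - x)))"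
    if "x \<in> {-1..0}" for x
    using sums_mult[OF sums[OF that], of x] by (simp add: b_def mult_ac)
  show "summable (\<lambda>n. a n / real (Suc n) ^ 1 * (-1) ^ Suc n)"
    using sums'[of "-1"] by (auto simp: sums_iff)
  have "uniform_limit {-1..0} (\<lambda>N x. \<Sum>n<N. (b (Suc n) - b n) * x ^ Suc n) d sequentially"
    unfolding d_def[abs_def] by (intro Weierstrass_m_test[OF _ M] bound) auto
  then have "continuous_on {-1..0} d"
    by (rule uniform_limit_theorem[rotated]) (auto intro!: always_eventually continuous_intros)
  \<comment> \<open>On this interval 1 - x is at least 1, so continuity of \<open>d\<close> passes
    to the closed form of the series.\<close>
  then have "continuous_on {-1..0} (\<lambda>x. x * ((b 0 + d x) / (1 - x)))"
    by (intro continuous_intros) auto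
  then show "continuous_on {-1..0} (genpolylog a 1)"
    by (rule continuous_on_eq) (use sums' in \<open>auto simp: genpolylog_def sums_iff\<close>)
qed

text \<open>Supplies the second assumption of \<open>genpolylog_at_minus_1\<close>: an increment is,
  up to sign, the nested sum of the tail divided by \<open>Suc n\<close>, and the weight cancels the
  denominator.\<close>

lemma sqrt_bounded_nested_sum_diff:
  assumes "set zs \<subseteq> {Plain 1, Barred 1}"
  shows "sqrt_bounded (\<lambda>n. real (Suc n) * (nested_sum zs (Suc n) - nested_sum zs n))"
proof (cases zs)
  case Nil
  then show ?thesis unfolding sqrt_bounded_def by (intro exI[of _ 0]) simp
next
  case (Cons z ws)
  have "sqrt_bounded (nested_sum ws)"
    using assms Cons by (intro sqrt_bounded_nested_sum) auto
  moreover have "\<bar>real (Suc n) * (nested_sum zs (Suc n) - nested_sum zs n)\<bar> = \<bar>nested_sum ws n\<bar>" for n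
    using assms Cons by (auto simp: abs_mult simp del: of_nat_Suc)
  ultimately show ?thesis unfolding sqrt_bounded_def by simp
qed

section \<open>Primitives and the explicit formulas\<close>

text \<open>This is what repeated integration by parts of \<open>ln u ^ j * F 0 u / u\<close> produces when
  \<open>F (l + 1)\<close> is a primitive of \<open>F l u / u\<close>.\<close>

definition log_primitive :: "nat \<Rightarrow> (nat \<Rightarrow> real \<Rightarrow> real) \<Rightarrow> real \<Rightarrow> real" where
  "log_primitive j F u = (\<Sum>l = 0..j. (-1) ^ l * real (j choose l) * fact l * ln u ^ (j - l) * F (Suc l) u)"

text \<open>One integration by parts: splitting off l = 0 leaves the same expression for the shifted
  family, by the absorption identity
  \<open>Suc l * (Suc j choose Suc l) = Suc j * (j choose l)\<close>.\<close>

lemma log_primitive_Suc: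
  "log_primitive (Suc j) F u = ln u ^ Suc j * F 1 u - real (Suc j) * log_primitive j (\<lambda>l. F (Suc l)) u"
proof -
  have coeff: "real (Suc j choose Suc l) * fact (Suc l) = real (Suc j) * (real (j choose l) * fact l)" for l
  proof -
    have "real (Suc l) * real (Suc j choose Suc l) = real (Suc j) * real (j choose l)"
      using Suc_times_binomial[of l j] by (metis of_nat_mult)
    then show ?thesis by (simp add: mult_ac del: of_nat_Suc binomial_Suc_Suc)
  qed
  have "log_primitive (Suc j) F u = ln u ^ Suc j * F 1 u +
      (\<Sum>l = 0..j. (-1) ^ Suc l * real (Suc j choose Suc l) * fact (Suc l) * ln u ^ (j - l) * F (Suc (Suc l)) u)"
    unfolding log_primitive_def
    by (subst sum.atLeast0_atMost_Suc_shift) (simp del: binomial_Suc_Suc fact_Suc)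
  also have "(\<Sum>l = 0..j. (-1) ^ Suc l * real (Suc j choose Suc l) * fact (Suc l) * ln u ^ (j - l) * F (Suc (Suc l)) u)
      = - (real (Suc j) * log_primitive j (\<lambda>l. F (Suc l)) u)"
    unfolding log_primitive_def sum_distrib_left sum_negf[symmetric]
  proof (intro sum.cong refl)
    fix l
    have "(-1) ^ Suc l * real (Suc j choose Suc l) * fact (Suc l) * ln u ^ (j - l) * F (Suc (Suc l)) u
        = (-1) ^ Suc l * (real (Suc j choose Suc l) * fact (Suc l)) * ln u ^ (j - l) * F (Suc (Suc l)) u"
      by (simp only: mult.assoc)
    then show "(-1) ^ Suc l * real (Suc j choose Suc l) * fact (Suc l) * ln u ^ (j - l) * F (Suc (Suc l)) u
        = - (real (Suc j) * ((-1) ^ l * real (j choose l) * fact l * ln u ^ (j - l) * F (Suc (Suc l)) u))"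
      unfolding coeff by (simp add: mult_ac del: of_nat_Suc)
  qed
  finally show ?thesis by simp
qed

text \<open>The product rule for \<open>ln u ^ Suc j * F 1 u\<close> leaves an unwanted term with
  \<open>ln u ^ j * F 1 u\<close>, which the primitive of the shifted family cancels; hence the
  induction over all \<open>F\<close>.\<close>

lemma has_real_derivative_log_primitive:
  assumes "u > 0" "\<And>l. (F (Suc l) has_real_derivative F l u / u) (at u)"
  shows "(log_primitive j F has_real_derivative ln u ^ j * F 0 u / u) (at u)"
  using assms(2)
proof (induction j arbitrary: F)
  case 0
  then show ?case by (simp add: log_primitive_def[abs_def])
next
  case (Suc j)
  have IH: "(log_primitive j (\<lambda>l. F (Suc l)) has_real_derivative ln u ^ j * F 1 u / u) (at u)"
    using Suc.IH[of "\<lambda>l. F (Suc l)"] Suc.prems by simp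
  have F: "(F 1 has_real_derivative F 0 u / u) (at u)" using Suc.prems[of 0] by simp
  have ln: "((\<lambda>u. ln u ^ Suc j) has_real_derivative real (Suc j) * ln u ^ j / u) (at u)"
    using assms(1) by (auto intro!: derivative_eq_intros simp del: power_Suc of_nat_Suc)
  have "((\<lambda>u. ln u ^ Suc j * F 1 u - real (Suc j) * log_primitive j (\<lambda>l. F (Suc l)) u)
      has_real_derivative ln u ^ Suc j * F 0 u / u) (at u)"
    by (rule DERIV_cong[OF DERIV_diff[OF DERIV_mult[OF ln F] DERIV_cmult[OF IH]]])
      (simp add: field_simps)
  then show ?case unfolding log_primitive_Suc[abs_def] .
qed

section \<open>Continuity of the primitives at the endpoints\<close>

text \<open>At 0 the polylogarithm vanishes to first order, and v * ln v ^ p tends to 0. The product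
  also has the value 0 there, whatever \<open>ln 0\<close> is.\<close>

lemma continuous_on_log_power_genpolylog:
  assumes "sqrt_bounded a"
  shows "continuous_on {0..1/2} (\<lambda>v. ln v ^ p * genpolylog a (Suc s) v)"
  unfolding continuous_on_eq_continuous_within
proof
  fix x :: real assume x: "x \<in> {0..1/2}"
  show "continuous (at x within {0..1/2}) (\<lambda>v. ln v ^ p * genpolylog a (Suc s) v)"
  proof (cases "x = 0")
    case False
    have "isCont (genpolylog a (Suc s)) x"
      using has_real_derivative_genpolylog[OF assms, of x s] x by (intro DERIV_isCont) auto
    then have "isCont (\<lambda>v. ln v ^ p * genpolylog a (Suc s) v) x"
      using False x by (intro continuous_intros) auto
    then show ?thesis by (rule continuous_at_imp_continuous_at_within)
  next
    case True
    have "((\<lambda>v. genpolylog a (Suc s) v / v) \<longlongrightarrow> (\<Sum>n. a n / real (Suc n) ^ s * 0 ^ n)) (at 0)"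
      using has_real_derivative_genpolylog[OF assms, of 0 s]
      by (simp add: has_field_derivative_iff genpolylog_0)
    then have 1: "((\<lambda>v. genpolylog a (Suc s) v / v) \<longlongrightarrow> (\<Sum>n. a n / real (Suc n) ^ s * 0 ^ n)) (at_right 0)"
      by (rule tendsto_mono[rotated]) (simp add: at_le)
    have 2: "((\<lambda>v::real. v * ln v ^ p) \<longlongrightarrow> 0) (at_right 0)"
      by real_asymp
    have "((\<lambda>v. v * ln v ^ p * (genpolylog a (Suc s) v / v)) \<longlongrightarrow> 0) (at_right 0)"
      using tendsto_mult[OF 2 1] by simp
    moreover have "\<forall>\<^sub>F v in at_right 0. v * ln v ^ p * (genpolylog a (Suc s) v / v)
        = ln v ^ p * genpolylog a (Suc s) v"
      by (rule eventually_at_right_less[THEN eventually_mono]) auto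
    ultimately have "((\<lambda>v. ln v ^ p * genpolylog a (Suc s) v) \<longlongrightarrow> 0) (at_right 0)"
      by (rule Lim_transform_eventually)
    then have "((\<lambda>v. ln v ^ p * genpolylog a (Suc s) v) \<longlongrightarrow> 0) (at 0 within {0..1/2})"
      by (simp add: at_within_Icc_at_right)
    then show ?thesis
      by (simp add: True continuous_within genpolylog_0)
  qed
qed

lemma continuous_on_log_primitive_genpolylog_0:
  assumes "sqrt_bounded a"
  shows "continuous_on {0..1/2} (log_primitive j (genpolylog a))"
  unfolding log_primitive_def[abs_def] mult.assoc
  by (intro continuous_on_sum continuous_on_mult_left continuous_on_log_power_genpolylog assms)

text \<open>The shifted family puts only exponents \<ge> 2 into the primitive, which is what makes
  it continuous up to 1.\<close>

lemma continuous_on_log_primitive_genpolylog_1: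
  assumes "sqrt_bounded a"
  shows "continuous_on {1/2..1} (log_primitive j (\<lambda>l. genpolylog a (Suc l)))"
proof -
  have "continuous_on {1/2..1} (genpolylog a (Suc (Suc l)))" for l
    by (rule continuous_on_subset[OF genpolylog_at_1(2)[OF assms]]) auto
  then show ?thesis
    unfolding log_primitive_def[abs_def] by (intro continuous_intros) auto
qed

section \<open>Integrals of products of halved logarithms\<close>

text \<open>In u = (1 + t) / 2 the factor (- ln (1 - u))^i / i! is the polylogarithm of exponent 1
  with i - 1 further ones, which forces i \<ge> 1.\<close>

lemma has_integral_log_product_ge_1:
  assumes "i \<ge> 1"
  shows "((\<lambda>t. ln ((1 - t) / 2) ^ i * ln ((1 + t) / 2) ^ j / (1 + t)) has_integral
      (-1) ^ (i + j) * fact i * fact j * mzeta (Plain (j + 2) # replicate (i - 1) (Plain 1))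
      - (\<Sum>l = 0..j. (-1) ^ (i + j) * fact i * fact l * real (j choose l) * ln 2 ^ (j - l) *
          mzeta_at ((l + 2) # replicate (i - 1) 1) (1 / 2))) {0..1}"
proof -
  define a where "a = nested_sum (replicate (i - 1) (Plain 1))"
  have a: "sqrt_bounded a" unfolding a_def by (intro sqrt_bounded_nested_sum) auto
  define P where "P = log_primitive j (\<lambda>l. genpolylog a (Suc l))"
  define G where "G t = (-1) ^ i * fact i * P ((1 + t) / 2)" for t
  have "((\<lambda>t. ln ((1 - t) / 2) ^ i * ln ((1 + t) / 2) ^ j / (1 + t)) has_integral (G 1 - G 0)) {0..1}"
  proof (rule fundamental_theorem_of_calculus_interior)
    have "continuous_on ((\<lambda>t::real. (1 + t) / 2) ` {0..1}) P"
      unfolding P_def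
      by (rule continuous_on_subset[OF continuous_on_log_primitive_genpolylog_1[OF a]]) auto
    then have "continuous_on {0..1} (\<lambda>t. P ((1 + t) / 2))"
      by (intro continuous_on_compose2[where f = "\<lambda>t::real. (1 + t) / 2" and g = P] continuous_intros) auto
    then show "continuous_on {0..1} G"
      unfolding G_def[abs_def] by (intro continuous_intros)
    fix t :: real assume t: "t \<in> {0<..<1}"
    define u where "u = (1 + t) / 2"
    have u: "0 < u" "\<bar>u\<bar> < 1" "u \<noteq> 0" using t by (auto simp: u_def)
    have "(P has_real_derivative ln u ^ j * genpolylog a (Suc 0) u / u) (at u)"
      unfolding P_def
      by (rule has_real_derivative_log_primitive has_real_derivative_genpolylog_div a u)+
    moreover have "genpolylog a (Suc 0) u = (- ln (1 - u)) ^ i / fact i"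
      using nested_sum_ones_series(2)[OF u(2), of "i - 1"] assms by (simp add: a_def)
    ultimately have P: "(P has_real_derivative ln u ^ j * ((- ln (1 - u)) ^ i / fact i) / u) (at u)"
      by simp
    have "((\<lambda>t::real. (1 + t) / 2) has_real_derivative 1 / 2) (at t)"
      by (auto intro!: derivative_eq_intros)
    from DERIV_cmult[OF DERIV_chain2[OF P[unfolded u_def] this], of "(-1) ^ i * fact i"]
    have "(G has_real_derivative (-1) ^ i * fact i * (ln u ^ j * ((- ln (1 - u)) ^ i / fact i) / u * (1 / 2))) (at t)"
      unfolding G_def[abs_def] u_def .
    moreover have "(-1) ^ i * fact i * (ln u ^ j * ((- ln (1 - u)) ^ i / fact i) / u * (1 / 2)) =
        ln (1 - u) ^ i * ln u ^ j / (2 * u)"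
      using u by (simp add: power_minus[of "ln (1 - u)"] field_simps flip: power_add mult_2)
    moreover have "2 * u = 1 + t" "1 - u = (1 - t) / 2" by (auto simp: u_def field_simps)
    ultimately show "(G has_vector_derivative ln ((1 - t) / 2) ^ i * ln ((1 + t) / 2) ^ j / (1 + t)) (at t)"
      unfolding has_real_derivative_iff_has_vector_derivative[symmetric] u_def[symmetric] by metis
  qed simp
  moreover have "G 1 = (-1) ^ (i + j) * fact i * fact j * mzeta (Plain (j + 2) # replicate (i - 1) (Plain 1))"
  proof -
    \<comment> \<open>Since ln 1 = 0, only the term without a logarithm survives.\<close>
    have "P 1 = (\<Sum>l = 0..j. if l = j then (-1) ^ j * fact j * genpolylog a (Suc (Suc j)) 1 else 0)"
      unfolding P_def log_primitive_def by (intro sum.cong) auto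
    also have "\<dots> = (-1) ^ j * fact j * genpolylog a (Suc (Suc j)) 1"
      by simp
    also have "genpolylog a (Suc (Suc j)) 1 = mzeta (Plain (j + 2) # replicate (i - 1) (Plain 1))"
      using mzeta_Plain_eq_genpolylog[OF genpolylog_at_1(1)[OF a[unfolded a_def], of "j + 2"]]
      by (simp add: a_def)
    finally show ?thesis by (simp add: G_def power_add)
  qed
  moreover have "G 0 = (\<Sum>l = 0..j. (-1) ^ (i + j) * fact i * fact l * real (j choose l) * ln 2 ^ (j - l) *
          mzeta_at ((l + 2) # replicate (i - 1) 1) (1 / 2))"
  proof -
    have "genpolylog a (Suc (Suc l)) (1 / 2) = mzeta_at ((l + 2) # replicate (i - 1) 1) (1 / 2)" for l
      using mzeta_at_eq_genpolylog[of "replicate (i - 1) 1" "l + 2" "1 / 2"]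
        sqrt_bounded_summable_Suc[OF a, of "1 / 2" "l + 2"]
      by (simp add: a_def)
    \<comment> \<open>Applied with x = ln 2: the sign of ln (1/2) = - ln 2 combines with (-1)^l into
      a sign independent of l.\<close>
    moreover have "(-1) ^ l * (- x) ^ (j - l) = (-1) ^ j * x ^ (j - l)" if "l \<le> j" for l and x :: real
      using that by (simp add: power_minus[of x] flip: power_add mult.assoc)
    ultimately show ?thesis
      unfolding G_def P_def log_primitive_def sum_distrib_left
      by (intro sum.cong) (auto simp: ln_div power_add)
  qed
  ultimately show ?thesis by simp
qed

text \<open>In v = (1 - t) / 2 the denominator 1 + t is 2 (1 - v), and the log power divided by 1 -
  v is a polylogarithm of exponent 0 over v. One exponent lower than in the previous lemma, the
  construction also works for i = 0 and j = 0.\<close>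

lemma has_integral_log_product:
  "((\<lambda>t. ln ((1 - t) / 2) ^ i * ln ((1 + t) / 2) ^ j / (1 + t)) has_integral
      (\<Sum>l = 0..i. (-1) ^ (i + j) * fact j * fact l * real (i choose l) * ln 2 ^ (i - l) *
          mzeta_at ((l + 1) # replicate j 1) (1 / 2))) {0..1}"
proof -
  define a where "a = nested_sum (replicate j (Plain 1))"
  have a: "sqrt_bounded a" unfolding a_def by (intro sqrt_bounded_nested_sum) auto
  define P where "P = log_primitive i (genpolylog a)"
  define G where "G t = - ((-1) ^ j * fact j * P ((1 - t) / 2))" for t
  have "((\<lambda>t. ln ((1 - t) / 2) ^ i * ln ((1 + t) / 2) ^ j / (1 + t)) has_integral (G 1 - G 0)) {0..1}"
  proof (rule fundamental_theorem_of_calculus_interior)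
    have "continuous_on ((\<lambda>t::real. (1 - t) / 2) ` {0..1}) P"
      unfolding P_def
      by (rule continuous_on_subset[OF continuous_on_log_primitive_genpolylog_0[OF a]]) auto
    then have "continuous_on {0..1} (\<lambda>t. P ((1 - t) / 2))"
      by (intro continuous_on_compose2[where f = "\<lambda>t::real. (1 - t) / 2" and g = P] continuous_intros) auto
    then show "continuous_on {0..1} G"
      unfolding G_def[abs_def] by (intro continuous_intros)
    fix t :: real assume t: "t \<in> {0<..<1}"
    define v where "v = (1 - t) / 2"
    have v: "0 < v" "\<bar>v\<bar> < 1" "v \<noteq> 0" using t by (auto simp: v_def)
    have "(P has_real_derivative ln v ^ i * genpolylog a 0 v / v) (at v)"
      unfolding P_def
      by (rule has_real_derivative_log_primitive has_real_derivative_genpolylog_div a v)+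
    moreover have "genpolylog a 0 v / v = (- ln (1 - v)) ^ j / fact j / (1 - v)"
    proof -
      have "genpolylog a 0 v = v * (\<Sum>n. nested_sum (replicate j (Plain 1)) n * v ^ n)"
        using suminf_mult[OF sqrt_bounded_summable[OF a v(2), of 0], of v]
        by (simp add: genpolylog_def a_def mult_ac)
      then show ?thesis using v(3) by (simp only: nested_sum_ones_series(1)[OF v(2)]) simp
    qed
    ultimately have P: "(P has_real_derivative ln v ^ i * ((- ln (1 - v)) ^ j / fact j / (1 - v))) (at v)"
      by (metis times_divide_eq_right)
    have "((\<lambda>t::real. (1 - t) / 2) has_real_derivative - 1 / 2) (at t)"
      by (auto intro!: derivative_eq_intros)
    from DERIV_minus[OF DERIV_cmult[OF DERIV_chain2[OF P[unfolded v_def] this], of "(-1) ^ j * fact j"]]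
    have "(G has_real_derivative - ((-1) ^ j * fact j * (ln v ^ i * ((- ln (1 - v)) ^ j / fact j / (1 - v)) * (- 1 / 2)))) (at t)"
      unfolding G_def[abs_def] v_def .
    moreover have "- ((-1) ^ j * fact j * (ln v ^ i * ((- ln (1 - v)) ^ j / fact j / (1 - v)) * (- 1 / 2))) =
        ln v ^ i * ln (1 - v) ^ j / (2 * (1 - v))"
      by (simp add: power_minus[of "ln (1 - v)"] mult_ac)
    moreover have "2 * (1 - v) = 1 + t" "1 - v = (1 + t) / 2" by (auto simp: v_def field_simps)
    ultimately show "(G has_vector_derivative ln ((1 - t) / 2) ^ i * ln ((1 + t) / 2) ^ j / (1 + t)) (at t)"
      unfolding has_real_derivative_iff_has_vector_derivative[symmetric] v_def[symmetric] by metis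
  qed simp
  moreover have "G 1 = 0"
    by (simp add: G_def P_def log_primitive_def genpolylog_0)
  moreover have "G 0 = - (\<Sum>l = 0..i. (-1) ^ (i + j) * fact j * fact l * real (i choose l) * ln 2 ^ (i - l) *
          mzeta_at ((l + 1) # replicate j 1) (1 / 2))"
  proof -
    have "genpolylog a (Suc l) (1 / 2) = mzeta_at ((l + 1) # replicate j 1) (1 / 2)" for l
      using mzeta_at_eq_genpolylog[of "replicate j 1" "l + 1" "1 / 2"]
        sqrt_bounded_summable_Suc[OF a, of "1 / 2" "l + 1"]
      by (simp add: a_def)
    moreover have "(-1) ^ l * (- x) ^ (i - l) = (-1) ^ i * x ^ (i - l)" if "l \<le> i" for l and x :: real
      using that by (simp add: power_minus[of x] flip: power_add mult.assoc)
    ultimately show ?thesis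
      unfolding G_def P_def log_primitive_def sum_distrib_left sum_negf[symmetric]
      by (intro sum.cong) (auto simp: ln_div power_add)
  qed
  ultimately show ?thesis by simp
qed

section \<open>Binomial expansion and the two formulas for \<open>J\<close>\<close>

lemma ln_power_binomial:
  assumes "x > 0"
  shows "ln x ^ k = (\<Sum>i = 0..k. real (k choose i) * ln 2 ^ (k - i) * ln (x / 2) ^ i)"
proof -
  have "ln x ^ k = (ln (x / 2) + ln 2) ^ k" using assms by (simp add: ln_div)
  also have "\<dots> = (\<Sum>i = 0..k. real (k choose i) * ln 2 ^ (k - i) * ln (x / 2) ^ i)"
    unfolding binomial_ring atLeast0AtMost by (simp add: mult_ac)
  finally show ?thesis .
qed

lemma ln_product_binomial:
  assumes "t \<in> {0..<1}"
  shows "ln (1 - t) ^ k * ln (1 + t) ^ m / (1 + t) =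
    (\<Sum>i = 0..k. \<Sum>j = 0..m. real (k choose i) * real (m choose j) * ln 2 ^ (m - j + (k - i)) *
      (ln ((1 - t) / 2) ^ i * ln ((1 + t) / 2) ^ j / (1 + t)))"
proof -
  have "ln (1 - t) ^ k * ln (1 + t) ^ m / (1 + t) =
    (\<Sum>i = 0..k. \<Sum>j = 0..m. real (k choose i) * ln 2 ^ (k - i) * ln ((1 - t) / 2) ^ i *
       (real (m choose j) * ln 2 ^ (m - j) * ln ((1 + t) / 2) ^ j) / (1 + t))"
    using assms by (simp add: ln_power_binomial[of "1 - t" k] ln_power_binomial[of "1 + t" m] sum_product
        flip: sum_divide_distrib)
  then show ?thesis by (simp only: power_add times_divide_eq_right mult_ac)
qed

lemma J_half_point_formula:
  "J k m = (\<Sum>i = 0..k. \<Sum>j = 0..m. \<Sum>l = 0..i.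
            (-1) ^ (i + j) * fact j * fact l * ln 2 ^ (m + k - j - l) *
            real (k choose i) * real (i choose l) * real (m choose j) *
            mzeta_at ([l + 1] @ replicate j 1) (1 / 2))"
proof -
  have "((\<lambda>t. \<Sum>i = 0..k. \<Sum>j = 0..m. real (k choose i) * real (m choose j) * ln 2 ^ (m - j + (k - i)) *
      (ln ((1 - t) / 2) ^ i * ln ((1 + t) / 2) ^ j / (1 + t))) has_integral
     (\<Sum>i = 0..k. \<Sum>j = 0..m. real (k choose i) * real (m choose j) * ln 2 ^ (m - j + (k - i)) *
      (\<Sum>l = 0..i. (-1) ^ (i + j) * fact j * fact l * real (i choose l) * ln 2 ^ (i - l) *
          mzeta_at ((l + 1) # replicate j 1) (1 / 2)))) {0..1}"
    by (intro has_integral_sum has_integral_mult_right has_integral_log_product) auto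
  \<comment> \<open>The expansion requires 1 - t > 0, so t = 1 is discarded as a negligible
    set.\<close>
  then have "((\<lambda>t. ln (1 - t) ^ k * ln (1 + t) ^ m / (1 + t)) has_integral
     (\<Sum>i = 0..k. \<Sum>j = 0..m. real (k choose i) * real (m choose j) * ln 2 ^ (m - j + (k - i)) *
      (\<Sum>l = 0..i. (-1) ^ (i + j) * fact j * fact l * real (i choose l) * ln 2 ^ (i - l) *
          mzeta_at ((l + 1) # replicate j 1) (1 / 2)))) {0..1}"
    by (rule has_integral_spike_finite[where S = "{1}", rotated 2]) (auto simp: ln_product_binomial)
  then have "J k m = (\<Sum>i = 0..k. \<Sum>j = 0..m. real (k choose i) * real (m choose j) * ln 2 ^ (m - j + (k - i)) *
      (\<Sum>l = 0..i. (-1) ^ (i + j) * fact j * fact l * real (i choose l) * ln 2 ^ (i - l) *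
          mzeta_at ((l + 1) # replicate j 1) (1 / 2)))"
    unfolding J_def by (rule integral_unique)
  also have "\<dots> = (\<Sum>i = 0..k. \<Sum>j = 0..m. \<Sum>l = 0..i.
            (-1) ^ (i + j) * fact j * fact l * ln 2 ^ (m + k - j - l) *
            real (k choose i) * real (i choose l) * real (m choose j) *
            mzeta_at ([l + 1] @ replicate j 1) (1 / 2))"
    unfolding sum_distrib_left
  proof (intro sum.cong refl)
    fix i j l assume "i \<in> {0..k}" "j \<in> {0..m}" "l \<in> {0..i}"
    then have "m + k - j - l = m - j + (k - i) + (i - l)" by auto
    then have exp: "(ln 2 :: real) ^ (m + k - j - l) = ln 2 ^ (m - j + (k - i)) * ln 2 ^ (i - l)"
      by (simp only: power_add)
    show "real (k choose i) * real (m choose j) * ln 2 ^ (m - j + (k - i)) *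
      ((-1) ^ (i + j) * fact j * fact l * real (i choose l) * ln 2 ^ (i - l) *
          mzeta_at ((l + 1) # replicate j 1) (1 / 2)) =
       (-1) ^ (i + j) * fact j * fact l * ln 2 ^ (m + k - j - l) *
            real (k choose i) * real (i choose l) * real (m choose j) *
            mzeta_at ([l + 1] @ replicate j 1) (1 / 2)"
      unfolding exp by (simp add: mult_ac)
  qed
  finally show ?thesis .
qed

lemma has_integral_ln_power:
  "((\<lambda>t. ln (1 + t) ^ m / (1 + t)) has_integral (ln 2 ^ Suc m / (real m + 1))) {0..1}"
proof -
  have "((\<lambda>t. ln (1 + t) ^ m / (1 + t)) has_integral
      (ln (1 + 1) ^ Suc m / real (Suc m) - ln (1 + 0) ^ Suc m / real (Suc m))) {0..1::real}"
  proof (rule fundamental_theorem_of_calculus_interior)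
    show "continuous_on {0..1::real} (\<lambda>t. ln (1 + t) ^ Suc m / real (Suc m))"
      by (intro continuous_intros) auto
    fix t :: real assume "t \<in> {0<..<1}"
    then have "((\<lambda>t. ln (1 + t) ^ Suc m / real (Suc m)) has_real_derivative
        real (Suc m) * ln (1 + t) ^ m * (1 / (1 + t)) / real (Suc m)) (at t)"
      by (auto intro!: derivative_eq_intros simp del: of_nat_Suc power_Suc)
    then show "((\<lambda>t. ln (1 + t) ^ Suc m / real (Suc m)) has_vector_derivative ln (1 + t) ^ m / (1 + t)) (at t)"
      by (simp add: has_real_derivative_iff_has_vector_derivative del: of_nat_Suc power_Suc)
  qed simp
  then show ?thesis by (simp add: add.commute)
qed

text \<open>The terms with i = 0 have no representation by
  \<open>has_integral_log_product_ge_1\<close>; undoing the binomial expansion of ln (1 + t)^m in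
  them gives an elementary integral, the isolated first summand.\<close>

lemma J_zeta_formula:
  "J k m = ln 2 ^ (m + k + 1) / (real m + 1)
        + (\<Sum>i = 1..k. \<Sum>j = 0..m.
            (-1) ^ (i + j) * fact i * fact j * ln 2 ^ (m + k - i - j) *
            real (k choose i) * real (m choose j) *
            mzeta ([Plain (j + 2)] @ replicate (i - 1) (Plain 1)))
        - (\<Sum>i = 1..k. \<Sum>j = 0..m. \<Sum>l = 0..j.
            (-1) ^ (i + j) * fact i * fact l * ln 2 ^ (m + k - i - l) *
            real (k choose i) * real (m choose j) * real (j choose l) *
            mzeta_at ([l + 2] @ replicate (i - 1) 1) (1 / 2))"
proof -
  define A where "A i j = (-1) ^ (i + j) * fact i * fact j * mzeta (Plain (j + 2) # replicate (i - 1) (Plain 1))" for i j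
  define B where "B i j l = (-1) ^ (i + j) * fact i * fact l * real (j choose l) * ln 2 ^ (j - l) *
          mzeta_at ((l + 2) # replicate (i - 1) 1) (1 / 2)" for i j l
  define c :: "nat \<Rightarrow> nat \<Rightarrow> real"
    where "c i j = real (k choose i) * real (m choose j) * ln 2 ^ (m - j + (k - i))" for i j
  have int: "((\<lambda>t. ln 2 ^ k * (ln (1 + t) ^ m / (1 + t)) + (\<Sum>i = 1..k. \<Sum>j = 0..m. c i j *
      (ln ((1 - t) / 2) ^ i * ln ((1 + t) / 2) ^ j / (1 + t)))) has_integral
     (ln 2 ^ k * (ln 2 ^ Suc m / (real m + 1)) + (\<Sum>i = 1..k. \<Sum>j = 0..m. c i j *
      (A i j - (\<Sum>l = 0..j. B i j l))))) {0..1}"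
    unfolding A_def B_def
    by (intro has_integral_add has_integral_sum has_integral_mult_right has_integral_log_product_ge_1
        has_integral_ln_power) auto
  have eq: "ln (1 - t) ^ k * ln (1 + t) ^ m / (1 + t) =
      ln 2 ^ k * (ln (1 + t) ^ m / (1 + t)) + (\<Sum>i = 1..k. \<Sum>j = 0..m. c i j *
      (ln ((1 - t) / 2) ^ i * ln ((1 + t) / 2) ^ j / (1 + t)))" if "t \<in> {0..<1}" for t
  proof -
    have "(\<Sum>j = 0..m. c 0 j * (ln ((1 - t) / 2) ^ 0 * ln ((1 + t) / 2) ^ j / (1 + t))) =
        ln 2 ^ k * (ln (1 + t) ^ m / (1 + t))"
    proof -
      have "c 0 j = ln 2 ^ k * (real (m choose j) * ln 2 ^ (m - j))" for j
        unfolding c_def power_add by simp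
      then have "(\<Sum>j = 0..m. c 0 j * (ln ((1 - t) / 2) ^ 0 * ln ((1 + t) / 2) ^ j / (1 + t))) =
          ln 2 ^ k * ((\<Sum>j = 0..m. real (m choose j) * ln 2 ^ (m - j) * ln ((1 + t) / 2) ^ j) / (1 + t))"
        by (simp add: sum_distrib_left sum_divide_distrib mult.assoc)
      then show ?thesis
        using that by (subst ln_power_binomial) auto
    qed
    then show ?thesis
      unfolding ln_product_binomial[OF that] c_def[symmetric]
      by (subst sum.atLeast_Suc_atMost) (auto simp del: power_0)
  qed
  have "((\<lambda>t. ln (1 - t) ^ k * ln (1 + t) ^ m / (1 + t)) has_integral
     (ln 2 ^ k * (ln 2 ^ Suc m / (real m + 1)) + (\<Sum>i = 1..k. \<Sum>j = 0..m. c i j *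
      (A i j - (\<Sum>l = 0..j. B i j l))))) {0..1}"
    by (rule has_integral_spike_finite[where S = "{1}", OF _ _ int]) (simp, rule eq, simp)
  then have "J k m = ln 2 ^ k * (ln 2 ^ Suc m / (real m + 1)) + (\<Sum>i = 1..k. \<Sum>j = 0..m. c i j *
      (A i j - (\<Sum>l = 0..j. B i j l)))"
    unfolding J_def by (rule integral_unique)
  also have "\<dots> = ln 2 ^ (m + k + 1) / (real m + 1) + (\<Sum>i = 1..k. \<Sum>j = 0..m. c i j * A i j)
      - (\<Sum>i = 1..k. \<Sum>j = 0..m. \<Sum>l = 0..j. c i j * B i j l)"
    by (simp add: right_diff_distrib sum_subtractf sum_distrib_left power_add mult_ac)
  also have "(\<Sum>i = 1..k. \<Sum>j = 0..m. c i j * A i j) = (\<Sum>i = 1..k. \<Sum>j = 0..m.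
            (-1) ^ (i + j) * fact i * fact j * ln 2 ^ (m + k - i - j) *
            real (k choose i) * real (m choose j) *
            mzeta ([Plain (j + 2)] @ replicate (i - 1) (Plain 1)))"
  proof (intro sum.cong refl)
    fix i j assume "i \<in> {1..k}" "j \<in> {0..m}"
    then have exp: "m - j + (k - i) = m + k - i - j" by auto
    show "c i j * A i j = (-1) ^ (i + j) * fact i * fact j * ln 2 ^ (m + k - i - j) *
            real (k choose i) * real (m choose j) *
            mzeta ([Plain (j + 2)] @ replicate (i - 1) (Plain 1))"
      unfolding c_def A_def exp by (simp add: mult_ac)
  qed
  also have "(\<Sum>i = 1..k. \<Sum>j = 0..m. \<Sum>l = 0..j. c i j * B i j l) = (\<Sum>i = 1..k. \<Sum>j = 0..m. \<Sum>l = 0..j.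
            (-1) ^ (i + j) * fact i * fact l * ln 2 ^ (m + k - i - l) *
            real (k choose i) * real (m choose j) * real (j choose l) *
            mzeta_at ([l + 2] @ replicate (i - 1) 1) (1 / 2))"
  proof (intro sum.cong refl)
    fix i j l assume "i \<in> {1..k}" "j \<in> {0..m}" "l \<in> {0..j}"
    then have "m + k - i - l = m - j + (k - i) + (j - l)" by auto
    then have exp: "(ln 2 :: real) ^ (m + k - i - l) = ln 2 ^ (m - j + (k - i)) * ln 2 ^ (j - l)"
      by (simp only: power_add)
    show "c i j * B i j l = (-1) ^ (i + j) * fact i * fact l * ln 2 ^ (m + k - i - l) *
            real (k choose i) * real (m choose j) * real (j choose l) *
            mzeta_at ([l + 2] @ replicate (i - 1) 1) (1 / 2)"
      unfolding exp c_def B_def by (simp add: mult_ac)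
  qed
  finally show ?thesis .
qed

section \<open>The alternating zeta values\<close>

text \<open>With \<open>q p t = \<zeta>(1, {1}\<^sub>p, bar 1, {1}\<^sub>r; -t)\<close> one has \<open>q (p + 1)' = - q p / (1 + t)\<close>, so the derivative of
  \<open>\<Sum>i\<le>M. ln (1 + t) ^ i / i! * q (M - i) t\<close> telescopes to a multiple of the integrand of \<open>J\<close>.\<close>

lemma alternating_mzeta_convolution:
  fixes M r :: nat
  shows "(\<Sum>i = 0..M. ln 2 ^ i / fact i *
      mzeta ([Barred 1] @ replicate (M - i) (Plain 1) @ [Barred 1] @ replicate r (Plain 1))) =
    (-1) ^ r / (fact (Suc r) * fact M) * J (Suc r) M"
proof -
  define Z where "Z p = replicate p (Plain 1) @ [Barred 1] @ replicate r (Plain 1)" for p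
  have Z: "set (Z p) \<subseteq> {Plain 1, Barred 1}" for p by (auto simp: Z_def)
  note bounded = sqrt_bounded_nested_sum[OF Z]
  note at_1 = genpolylog_at_minus_1[OF sqrt_bounded_nested_sum[OF Z] sqrt_bounded_nested_sum_diff[OF Z]]
  define q where "q p t = genpolylog (nested_sum (Z p)) 1 (- t)" for p t
  define h where "h t = (- ln (1 - t)) ^ Suc r / fact (Suc r)" for t :: real
  have q_deriv: "(q p has_real_derivative - (case p of 0 \<Rightarrow> h t | Suc p' \<Rightarrow> q p' t) / (1 + t)) (at t)"
    if t: "t \<in> {0<..<1}" for p t
  proof -
    have t': "\<bar>- t\<bar> < 1" "\<bar>t\<bar> < 1" using t by auto
    have ser: "(\<Sum>n. nested_sum (Z p) n * (- t) ^ n) = (case p of 0 \<Rightarrow> h t | Suc p' \<Rightarrow> q p' t) / (1 + t)"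
    proof (cases p)
      case 0
      \<comment> \<open>The barred entry reflects -t back to t, so the innermost block of ones
        becomes a power of ln (1 - t).\<close>
      have "(\<Sum>n. nested_sum (Barred 1 # replicate r (Plain 1)) n * (- t) ^ n) =
          genpolylog (nested_sum (replicate r (Plain 1))) 1 (- (- t)) / (1 - (- t))"
        by (rule nested_sum_Barred_series[OF _ t'(1)]) auto
      moreover have "Z 0 = Barred 1 # replicate r (Plain 1)" by (simp add: Z_def)
      ultimately show ?thesis
        unfolding 0 minus_minus nested_sum_ones_series(2)[OF t'(2)] by (simp add: h_def)
    next
      case (Suc p')
      have "Z (Suc p') = Plain 1 # Z p'" by (simp add: Z_def)
      then show ?thesis
        using nested_sum_Plain_series[OF Z[of p'] t'(1)] by (simp add: Suc q_def del: nested_sum.simps)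
    qed
    have "(genpolylog (nested_sum (Z p)) 1 has_real_derivative
        (case p of 0 \<Rightarrow> h t | Suc p' \<Rightarrow> q p' t) / (1 + t)) (at (- t))"
      using has_real_derivative_genpolylog[OF bounded t'(1), of p 0] by (simp add: ser)
    then show ?thesis
      unfolding q_def[abs_def] DERIV_mirror by simp
  qed
  define R where "R t = (\<Sum>i = 0..M. ln (1 + t) ^ i / fact i * q (M - i) t)" for t
  have "((\<lambda>t. - (ln (1 + t) ^ M / fact M * h t / (1 + t))) has_integral (R 1 - R 0)) {0..1}"
  proof (rule fundamental_theorem_of_calculus_interior)
    have "continuous_on {0..1} (q p)" for p
      unfolding q_def[abs_def]
      by (rule continuous_on_compose2[OF at_1(2)]) (auto intro!: continuous_intros)
    then show "continuous_on {0..1} R"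
      unfolding R_def[abs_def] by (intro continuous_intros) auto
    fix t :: real assume t: "t \<in> {0<..<1}"
    define E where "E i = ln (1 + t) ^ i / fact i / (1 + t)" for i
    \<comment> \<open>\<open>Q p\<close> is \<open>q (p - 1)\<close> with \<open>h\<close> in the
      place of index -1, so the derivative of \<open>q p\<close> is \<open>- Q p / (1 + t)\<close>
      for every \<open>p\<close>.\<close>
    define Q where "Q p = (case p of 0 \<Rightarrow> h t | Suc p' \<Rightarrow> q p' t)" for p
    have ln: "((\<lambda>t. ln (1 + t) ^ i / fact i) has_real_derivative (case i of 0 \<Rightarrow> 0 | Suc i' \<Rightarrow> E i')) (at t)" for i
    proof (cases i)
      case (Suc i')
      have "((\<lambda>t. ln (1 + t) ^ Suc i' / fact (Suc i')) has_real_derivative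
          real (Suc i') * ln (1 + t) ^ i' * (1 / (1 + t)) / fact (Suc i')) (at t)"
        using t by (auto intro!: derivative_eq_intros simp del: of_nat_Suc power_Suc fact_Suc)
      then show ?thesis by (simp add: Suc E_def mult.commute del: of_nat_Suc power_Suc)
    qed simp
    have "(R has_real_derivative
        (\<Sum>i = 0..M. (case i of 0 \<Rightarrow> 0 | Suc i' \<Rightarrow> E i') * q (M - i) t
          + - Q (M - i) / (1 + t) * (ln (1 + t) ^ i / fact i))) (at t)"
      unfolding R_def[abs_def] Q_def by (intro DERIV_sum DERIV_mult ln q_deriv t)
    also have "(\<Sum>i = 0..M. (case i of 0 \<Rightarrow> 0 | Suc i' \<Rightarrow> E i') * q (M - i) t
          + - Q (M - i) / (1 + t) * (ln (1 + t) ^ i / fact i)) =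
        (\<Sum>i = 0..M. (case i of 0 \<Rightarrow> 0 | Suc i' \<Rightarrow> E i') * q (M - i) t) - (\<Sum>i = 0..M. E i * Q (M - i))"
      by (simp add: E_def sum_subtractf mult_ac)
    \<comment> \<open>Shifting the index in the first sum matches it with the second one except for
      i = M, the only place where \<open>h\<close> occurs.\<close>
    also have "\<dots> = - (E M * h t)"
    proof (cases M)
      case 0
      then show ?thesis by (simp add: Q_def)
    next
      case (Suc N)
      have 1: "(\<Sum>i = 0..M. (case i of 0 \<Rightarrow> 0 | Suc i' \<Rightarrow> E i') * q (M - i) t) = (\<Sum>i = 0..N. E i * q (N - i) t)"
        unfolding Suc by (subst sum.atLeast0_atMost_Suc_shift) simp
      have 2: "(\<Sum>i = 0..M. E i * Q (M - i)) = (\<Sum>i = 0..N. E i * q (N - i) t) + E M * h t"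
        unfolding Suc by (auto simp: Q_def Suc_diff_le intro!: sum.cong)
      show ?thesis unfolding 1 2 by simp
    qed
    finally show "(R has_vector_derivative - (ln (1 + t) ^ M / fact M * h t / (1 + t))) (at t)"
      by (simp add: has_real_derivative_iff_has_vector_derivative E_def)
  qed simp
  moreover have "R 0 = 0"
    by (simp add: R_def q_def genpolylog_0)
  moreover have "R 1 = (\<Sum>i = 0..M. ln 2 ^ i / fact i *
      mzeta ([Barred 1] @ replicate (M - i) (Plain 1) @ [Barred 1] @ replicate r (Plain 1)))"
  proof -
    have "mzeta (Barred 1 # Z p) = q p 1" for p
      unfolding q_def by (intro mzeta_Barred_eq_genpolylog at_1)
    then show ?thesis by (simp add: R_def Z_def)
  qed
  moreover have "- (ln (1 + t) ^ M / fact M * h t / (1 + t)) =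
      (-1) ^ r / (fact (Suc r) * fact M) * (ln (1 - t) ^ Suc r * ln (1 + t) ^ M / (1 + t))" for t
    unfolding h_def power_minus[of "ln (1 - t)" "Suc r"] by (simp add: mult_ac del: fact_Suc)
  ultimately have int: "((\<lambda>t. (-1) ^ r / (fact (Suc r) * fact M) * (ln (1 - t) ^ Suc r * ln (1 + t) ^ M / (1 + t)))
      has_integral (\<Sum>i = 0..M. ln 2 ^ i / fact i *
      mzeta ([Barred 1] @ replicate (M - i) (Plain 1) @ [Barred 1] @ replicate r (Plain 1)))) {0..1}"
    by simp
  show ?thesis
    unfolding J_def integral_mult_right[symmetric] using integral_unique[OF int] by simp
qed

theorem theorem2p2:
  shows
   "(\<forall>m k :: nat. m \<ge> 1 \<longrightarrow> k \<ge> 1 \<longrightarrow>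
      mzeta ([Barred 1] @ replicate (m - 1) (Plain 1) @ [Barred 1] @ replicate (k - 1) (Plain 1)) =
        (-1) ^ (k - 1) / (fact k * fact (m - 1)) * J k (m - 1)
        - (\<Sum>i = 1..m - 1. ln 2 ^ i / fact i *
            mzeta ([Barred 1] @ replicate (m - 1 - i) (Plain 1) @
                   [Barred 1] @ replicate (k - 1) (Plain 1)))) \<and>
    (\<forall>k m :: nat. k \<ge> 1 \<longrightarrow>
      J k m =
        ln 2 ^ (m + k + 1) / (real m + 1)
        + (\<Sum>i = 1..k. \<Sum>j = 0..m.
            (-1) ^ (i + j) * fact i * fact j * ln 2 ^ (m + k - i - j) *
            real (k choose i) * real (m choose j) *
            mzeta ([Plain (j + 2)] @ replicate (i - 1) (Plain 1)))
        - (\<Sum>i = 1..k. \<Sum>j = 0..m. \<Sum>l = 0..j.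
            (-1) ^ (i + j) * fact i * fact l * ln 2 ^ (m + k - i - l) *
            real (k choose i) * real (m choose j) * real (j choose l) *
            mzeta_at ([l + 2] @ replicate (i - 1) 1) (1 / 2)) \<and>
      J k m =
        (\<Sum>i = 0..k. \<Sum>j = 0..m. \<Sum>l = 0..i.
            (-1) ^ (i + j) * fact j * fact l * ln 2 ^ (m + k - j - l) *
            real (k choose i) * real (i choose l) * real (m choose j) *
            mzeta_at ([l + 1] @ replicate j 1) (1 / 2)))"
proof (intro conjI allI impI)
  fix m k :: nat
  assume "m \<ge> 1" "k \<ge> 1"
  \<comment> \<open>The term i = 0 of this convolution is the zeta value sought; the other terms are
    moved to the right-hand side.\<close>
  then have "(\<Sum>i = 0..m - 1. ln 2 ^ i / fact i *
      mzeta ([Barred 1] @ replicate (m - 1 - i) (Plain 1) @ [Barred 1] @ replicate (k - 1) (Plain 1))) =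
    (-1) ^ (k - 1) / (fact k * fact (m - 1)) * J k (m - 1)"
    using alternating_mzeta_convolution[of "m - 1" "k - 1"] by (simp del: fact_Suc)
  then show "mzeta ([Barred 1] @ replicate (m - 1) (Plain 1) @ [Barred 1] @ replicate (k - 1) (Plain 1)) =
        (-1) ^ (k - 1) / (fact k * fact (m - 1)) * J k (m - 1)
        - (\<Sum>i = 1..m - 1. ln 2 ^ i / fact i *
            mzeta ([Barred 1] @ replicate (m - 1 - i) (Plain 1) @
                   [Barred 1] @ replicate (k - 1) (Plain 1)))"
    by (subst (asm) sum.atLeast_Suc_atMost) simp_all
qed (rule J_zeta_formula J_half_point_formula)+

end
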